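(* Let $S$ be a numerical semigroup, let $d\in S$ be odd, and let $S\bowtie^d S$ be the numerical duplication of $S$ with respect to the ideal $E=S$ and $d$. Then: (i) If $d>2m(S)$, then $k[[S]]$ has maximal reduced type if and only if $k[[S\bowtie^d S]]$ has maximal reduced type. (ii) If $d<2m(S)$, then $k[[S\bowtie^d S]]$ has maximal reduced type if and only if $\frac{d-1}{2}\geq \mathrm{F}(S)-\min\mathrm{PF}(S)$.
   Context: $\mathbb{N}$ denotes the non-negative integers. A numerical semigroup is a submonoid $S$ of $(\mathbb{N},+)$ with $\mathbb{N}\setminus S$ finite. The multiplicity $m(S)$ is the smallest nonzero element of $S$, and the Frobenius number $\mathrm{F}(S)$ is the largest integer not in $S$. A pseudo-Frobenius number of $S$ is an integer $f\notin S$ with $f+s\in S$ for all $s\in S\setminus\{0\}$; $\mathrm{PF}(S)$ is the set of these. For an odd integer $d\in S$ and an ideal $E$ of $S$ (a subset $E\subseteq S$ with $S+E\subseteq E$), the numerical duplication is the numerical semigroup $S\bowtie^d E = 2\cdot S\cup(2\cdot E+d)$, where $2\cdot S=\{2s\mid s\in S\}$ and $2\cdot E+d=\{2e+d\mid e\in E\}$. Let $k$ be an algebraically closed field of characteristic zero. For $S$ with minimal generators $n_1,\ldots,n_e$, $R=k[[S]] := k[[t^{n_1},\ldots,t^{n_e}]]\subseteq k[[t]]$. The type, $\mathrm{type}(k[[S]])$, is the Cohen-Macaulay type of $k[[S]]$, which equals $|\mathrm{PF}(S)|$. With $K$ the quotient field of $R$, $\bar R$ its integral closure in $K$ and $\mathfrak{C}=(R:_K\bar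 R)$ the conductor ideal, the reduced type is $s(R)=\dim_k \frac{\mathfrak{C}+xR}{xR}$ with $x=t^{m(S)}$; it satisfies $1\le s(R)\le \mathrm{type}(R)$, and it is known to equal the number of integers in $[\mathrm{F}(S)-m(S)+1,\mathrm{F}(S)]\setminus S$. $R$ has maximal reduced type if $s(R)=\mathrm{type}(R)$. *)

theory Defs
  imports
    "HOL-Algebra.QuotRing"
    "HOL-Algebra.Embedded_Algebras"
    "HOL-Computational_Algebra.Formal_Laurent_Series"
    "HOL-Computational_Algebra.Polynomial"
begin

section \<open>Numerical semigroups\<close>

definition numerical_semigroup :: "nat set \<Rightarrow> bool" where
  "numerical_semigroup S \<longleftrightarrow>
     0 \<in> S \<and> (\<forall>a\<in>S. \<forall>b\<in>S. a + b \<in> S) \<and> finite (UNIV - S)"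

definition sg_multiplicity :: "nat set \<Rightarrow> nat" where
  "sg_multiplicity S = (LEAST n. n \<in> S \<and> n \<noteq> 0)"

text \<open>Gaps are taken in the integers, so that the Frobenius number and the only
  pseudo-Frobenius number of the semigroup of all naturals are \<open>-1\<close>.\<close>

definition frobenius :: "nat set \<Rightarrow> int" where
  "frobenius S = (GREATEST z. z \<notin> int ` S)"

definition pseudo_frobenius :: "nat set \<Rightarrow> int set" where
  "pseudo_frobenius S = {f. f \<notin> int ` S \<and> (\<forall>s\<in>S - {0}. f + int s \<in> int ` S)}"

definition numerical_duplication :: "nat set \<Rightarrow> nat set \<Rightarrow> nat \<Rightarrow> nat set" where
  "numerical_duplication S E d = {2 * s | s. s \<in> S} \<union> {2 * e + d | e. e \<in> E}"

definition minimal_generators :: "nat set \<Rightarrow> nat set" where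
  "minimal_generators S = {n \<in> S - {0}. \<not> (\<exists>a\<in>S - {0}. \<exists>b\<in>S - {0}. n = a + b)}"

section \<open>Semigroup rings\<close>

text \<open>\<open>k[[S]]\<close> is the image of the substitution \<open>x\<^sub>g \<mapsto> t ^ g\<close> from the formal power series ring
  over \<open>k\<close> with one variable \<open>x\<^sub>g\<close> for each minimal generator \<open>g\<close>.  A monomial is an exponent
  vector \<open>a\<close>, a power series is its coefficient function \<open>c\<close>, and the sum below is finite because
  the finitely many \<open>g\<close> are positive.  The ring is placed inside the Laurent series field,
  where its quotient field lives.\<close>

definition semigroup_ring :: "nat set \<Rightarrow> 'k::field fls set" where
  "semigroup_ring S =
     (let G = minimal_generators S in
      {fps_to_fls (Abs_fps (\<lambda>m. \<Sum>a \<in> {a \<in> G \<rightarrow>\<^sub>E UNIV. (\<Sum>g\<in>G. a g * g) = m}. c a))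
        | c :: (nat \<Rightarrow> nat) \<Rightarrow> 'k. True})"

definition ring_on :: "'a::field set \<Rightarrow> 'a ring" where
  "ring_on A = \<lparr>carrier = A, monoid.mult = (*), one = 1, zero = 0, add = (+)\<rparr>"

definition quotient_field :: "'a::field set \<Rightarrow> 'a set" where
  "quotient_field A = {a / b | a b. a \<in> A \<and> b \<in> A \<and> b \<noteq> 0}"

definition integral_closure :: "'a::field set \<Rightarrow> 'a set" where
  "integral_closure A =
     {z \<in> quotient_field A.
        \<exists>p. lead_coeff p = 1 \<and> (\<forall>i. coeff p i \<in> A) \<and> poly p z = 0}"

definition conductor_ideal :: "'a::field set \<Rightarrow> 'a set" where
  "conductor_ideal A = {z \<in> quotient_field A. \<forall>y\<in>integral_closure A. z * y \<in> A}"

section \<open>Type and reduced type\<close>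

text \<open>Below, \<open>A\<close> is a one-dimensional local domain containing the constants \<open>k\<close>, with residue
  field \<open>k\<close>, and \<open>x\<close> is a nonzero element of its maximal ideal.  Subspaces of \<open>A/xA\<close> are sets of
  cosets, and the scalars are the classes of the constants.\<close>

definition const_classes :: "'k::field fls set \<Rightarrow> 'k fls \<Rightarrow> 'k fls set set" where
  "const_classes A x =
     (\<lambda>c. (PIdl\<^bsub>ring_on A\<^esub> x) +>\<^bsub>ring_on A\<^esub> fls_const c) ` UNIV"

text \<open>The socle of \<open>A/xA\<close>; the maximal ideal of the local ring \<open>A\<close> is its set of nonunits.\<close>

definition quot_socle :: "'k::field fls set \<Rightarrow> 'k fls \<Rightarrow> 'k fls set set" where
  "quot_socle A x =
     (let R = ring_on A; I = PIdl\<^bsub>R\<^esub> x; Q = R Quot I in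
      {q \<in> carrier Q. \<forall>a \<in> carrier R - Units R. (I +>\<^bsub>R\<^esub> a) \<otimes>\<^bsub>Q\<^esub> q = \<zero>\<^bsub>Q\<^esub>})"

text \<open>The Cohen-Macaulay type of a one-dimensional Cohen-Macaulay local ring is the dimension of
  the socle modulo a parameter; it does not depend on the parameter.\<close>

definition cm_type :: "'k::field fls set \<Rightarrow> 'k fls \<Rightarrow> nat" where
  "cm_type A x =
     ring.dim (ring_on A Quot (PIdl\<^bsub>ring_on A\<^esub> x)) (const_classes A x) (quot_socle A x)"

definition reduced_type :: "'k::field fls set \<Rightarrow> 'k fls \<Rightarrow> nat" where
  "reduced_type A x =
     (let R = ring_on A; I = PIdl\<^bsub>R\<^esub> x in
      ring.dim (R Quot I) (const_classes A x)
        ((\<lambda>a. I +>\<^bsub>R\<^esub> a) ` (conductor_ideal A <+>\<^bsub>R\<^esub> I)))"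

text \<open>\<open>k[[S]]\<close> has maximal reduced type; the field \<open>k\<close> is passed as a type argument.\<close>

definition maximal_reduced_type :: "'k::field itself \<Rightarrow> nat set \<Rightarrow> bool" where
  "maximal_reduced_type k S \<longleftrightarrow>
     (let A = (semigroup_ring S :: 'k fls set); x = fls_X ^ sg_multiplicity S in
      reduced_type A x = cm_type A x)"

end

theory Submission
  imports Defs
begin

text \<open>Both the type and the reduced type of \<open>k[[S]]\<close> can be read off from the semigroup.  As a subring of
  the Laurent series, \<open>k[[S]]\<close> consists of the series supported in \<open>S\<close>; the ideal generated by \<open>t ^ m\<close>
  with \<open>m \<in> S\<close> consists of the series supported in \<open>m + S\<close>, and the conductor of the series
  supported above the Frobenius number \<open>F\<close>.  Whenever \<open>B \<subseteq> S\<close> is disjoint from \<open>m + S\<close>, the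
  monomials with exponent in \<open>B\<close> induce a basis of the image of the series supported in
  \<open>B \<union> (m + S)\<close> in the quotient by \<open>t ^ m\<close> (\<open>dim_cls_fls_on\<close>).  The socle of the quotient is such an
  image, with \<open>B\<close> the set of all \<open>f + m\<close> for \<open>f\<close> pseudo-Frobenius, because a series
  is killed by the maximal ideal exactly if every exponent in its support is moved into \<open>m + S\<close> by
  every nonzero element of \<open>S\<close> (\<open>cm_type_eq\<close>).  The image of the conductor is another, with
  \<open>B\<close> the set of all \<open>f + m\<close> for \<open>f\<close> a gap above \<open>F - m\<close> (\<open>reduced_type_eq\<close>).  For \<open>m\<close> the multiplicity, such
  gaps are pseudo-Frobenius, so the reduced type is maximal if and only if every
  pseudo-Frobenius number exceeds \<open>F - m\<close> (\<open>maximal_reduced_type_iff\<close>).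

  It remains to compare this criterion for \<open>S\<close> and for the duplication.  Since \<open>d\<close> is odd, parity
  separates the two copies of \<open>S\<close> in the duplication.  An even number \<open>2 f\<close> cannot be
  pseudo-Frobenius, since adding \<open>d\<close> would have to give an element, which forces \<open>f \<in> S\<close>.  Hence the
  pseudo-Frobenius numbers of the duplication are the \<open>2 f + d\<close> for \<open>f\<close> pseudo-Frobenius in \<open>S\<close>; its Frobenius
  number is \<open>2 F + d\<close> and its multiplicity is the minimum of \<open>2 m\<close> and \<open>d\<close>.  The criterion thus
  becomes \<open>2 (F - f) < min (2 m) d\<close> for all such \<open>f\<close>.  If \<open>d > 2 m\<close> this is the criterion for \<open>S\<close>
  itself, and if \<open>d < 2 m\<close> it is the bound on \<open>F\<close> minus the least pseudo-Frobenius number.\<close>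

unbundle fps_syntax

section \<open>Numerical semigroups\<close>

locale numsemi =
  fixes S :: "nat set"
  assumes numerical_semigroup: "numerical_semigroup S"
begin

lemma zero_mem: "0 \<in> S"
  and add_mem: "a \<in> S \<Longrightarrow> b \<in> S \<Longrightarrow> a + b \<in> S"
  and finite_gaps: "finite (UNIV - S)"
  using numerical_semigroup by (auto simp: numerical_semigroup_def)

lemma mult_mem: "a \<in> S \<Longrightarrow> k * a \<in> S"
  by (induction k) (auto simp: zero_mem add_mem)

lemma multiplicity_mem: "sg_multiplicity S \<in> S"
  and multiplicity_pos: "sg_multiplicity S > 0"
  and multiplicity_le: "s \<in> S \<Longrightarrow> s \<noteq> 0 \<Longrightarrow> sg_multiplicity S \<le> s"
proof -
  have "\<exists>n. n \<in> S \<and> n \<noteq> 0"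
  proof (rule ccontr)
    assume "\<not> ?thesis"
    then have "UNIV - {0} \<subseteq> UNIV - S" by auto
    with finite_gaps have "finite (UNIV - {0::nat})" by (rule finite_subset[rotated])
    then show False by simp
  qed
  from LeastI_ex[OF this] show "sg_multiplicity S \<in> S" "sg_multiplicity S > 0"
    by (auto simp: sg_multiplicity_def)
  show "s \<in> S \<Longrightarrow> s \<noteq> 0 \<Longrightarrow> sg_multiplicity S \<le> s"
    unfolding sg_multiplicity_def by (rule Least_le) simp
qed

text \<open>The gaps in the integers are unbounded below, so the maximum is taken over those that are at
  least \<open>-1\<close>: this set is finite, and it is nonempty because it contains \<open>-1\<close>.\<close>
lemma frobenius_gap: "frobenius S \<notin> int ` S"
  and gap_le_frobenius: "z \<notin> int ` S \<Longrightarrow> z \<le> frobenius S"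
proof -
  let ?G = "{z. z \<notin> int ` S \<and> z \<ge> -1}"
  have "?G \<subseteq> insert (-1) (int ` (UNIV - S))"
  proof
    fix z assume z: "z \<in> ?G"
    show "z \<in> insert (-1) (int ` (UNIV - S))"
    proof (cases "z = -1")
      case False
      with z have "z = int (nat z)" "nat z \<notin> S" by (auto simp: image_iff)
      then show ?thesis by blast
    qed simp
  qed
  then have fin: "finite ?G" using finite_gaps by (simp add: finite_subset)
  have ne: "-1 \<in> ?G" by auto
  have max: "z \<le> Max ?G" if "z \<notin> int ` S" for z
    using Max_ge[OF fin, of z] Max_ge[OF fin ne] that by (cases "z \<ge> -1") auto
  have mem: "Max ?G \<notin> int ` S" using Max_in[OF fin] ne by blast
  have "frobenius S = Max ?G"
    unfolding frobenius_def by (rule Greatest_equality) (use mem max in auto)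
  with mem max show "frobenius S \<notin> int ` S" "z \<notin> int ` S \<Longrightarrow> z \<le> frobenius S" by auto
qed

lemma frobenius_ge: "frobenius S \<ge> -1"
  by (rule gap_le_frobenius) auto

lemma above_frobenius: "int n > frobenius S \<Longrightarrow> n \<in> S"
  using gap_le_frobenius[of "int n"] by force

lemma frobenius_pseudo_frobenius: "frobenius S \<in> pseudo_frobenius S"
  using frobenius_gap gap_le_frobenius[of "frobenius S + int s" for s]
  by (fastforce simp: pseudo_frobenius_def)

lemma finite_pseudo_frobenius: "finite (pseudo_frobenius S)"
proof (rule finite_subset)
  show "pseudo_frobenius S \<subseteq> {- int (sg_multiplicity S)..frobenius S}"
    using gap_le_frobenius multiplicity_mem multiplicity_pos
    by (force simp: pseudo_frobenius_def)
qed simp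

end

lemma frobenius_eqI:
  assumes "F \<notin> int ` S" and "\<And>z. z > F \<Longrightarrow> z \<in> int ` S"
  shows "frobenius S = F"
  unfolding frobenius_def by (rule Greatest_equality) (use assms in \<open>auto simp: not_le[symmetric]\<close>)

section \<open>The numerical duplication along the semigroup itself\<close>

context numsemi
begin

text \<open>Membership is stated for integers, so that it also covers negative candidates for the Frobenius
  and pseudo-Frobenius numbers.\<close>
lemma even_mem_duplication:
  assumes "odd d"
  shows "2 * z \<in> int ` numerical_duplication S S d \<longleftrightarrow> z \<in> int ` S"
proof
  assume "2 * z \<in> int ` numerical_duplication S S d"
  then obtain n where n: "2 * z = int n" "n \<in> numerical_duplication S S d" by auto
  then have "even n" by presburger
  with n assms obtain s where "n = 2 * s" "s \<in> S"
    by (auto simp: numerical_duplication_def)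
  with n show "z \<in> int ` S" by auto
next
  assume "z \<in> int ` S"
  then obtain s where "s \<in> S" "z = int s" by auto
  then show "2 * z \<in> int ` numerical_duplication S S d"
    by (intro image_eqI[of _ _ "2 * s"]) (auto simp: numerical_duplication_def)
qed

lemma odd_mem_duplication:
  assumes "odd d"
  shows "2 * z + int d \<in> int ` numerical_duplication S S d \<longleftrightarrow> z \<in> int ` S"
proof
  assume "2 * z + int d \<in> int ` numerical_duplication S S d"
  then obtain n where n: "2 * z + int d = int n" "n \<in> numerical_duplication S S d" by auto
  then have "odd n" using assms by presburger
  with n obtain s where "n = 2 * s + d" "s \<in> S"
    by (auto simp: numerical_duplication_def)
  with n show "z \<in> int ` S" by auto
next
  assume "z \<in> int ` S"
  then obtain s where "s \<in> S" "z = int s" by auto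
  then show "2 * z + int d \<in> int ` numerical_duplication S S d"
    by (intro image_eqI[of _ _ "2 * s + d"]) (auto simp: numerical_duplication_def)
qed

lemma parity_cases:
  assumes "odd d"
  obtains w where "z = 2 * w" | w where "z = 2 * w + int d"
proof (cases "even z")
  case True then show ?thesis using that by (auto elim: evenE)
next
  case False
  with assms have "even (z - int d)" by simp
  then obtain w where "z - int d = 2 * w" by (rule evenE)
  then show ?thesis using that(2)[of w] by simp
qed

lemma numerical_semigroup_duplication:
  assumes "d \<in> S" and "odd d"
  shows "numerical_semigroup (numerical_duplication S S d)" (is "numerical_semigroup ?D")
  unfolding numerical_semigroup_def
proof (intro conjI ballI)
  show "0 \<in> ?D" using zero_mem by (auto simp: numerical_duplication_def)
  fix a b assume ab: "a \<in> ?D" "b \<in> ?D"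
  have mem: "2 * s \<in> ?D" "2 * s + d \<in> ?D" if "s \<in> S" for s
    using that by (auto simp: numerical_duplication_def)
  have double: "2 * s + d + (2 * t + d) = 2 * (s + t + d)" "2 * s + (2 * t + d) = 2 * (s + t) + d"
    "2 * s + d + 2 * t = 2 * (s + t) + d" "2 * s + 2 * t = 2 * (s + t)" for s t :: nat by auto
  from ab obtain s t where "s \<in> S" "t \<in> S" "a = 2 * s \<or> a = 2 * s + d" "b = 2 * t \<or> b = 2 * t + d"
    by (auto simp: numerical_duplication_def)
  then show "a + b \<in> ?D"
    using mem add_mem \<open>d \<in> S\<close> by (elim disjE) (simp_all only: double)
next
  have "n \<in> ?D" if "int n > 2 * frobenius S + int d" for n
  proof -
    have "int n \<in> int ` ?D"
    proof (cases "int n" rule: parity_cases[OF \<open>odd d\<close>])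
      case (1 w)
      with that frobenius_ge have "w > frobenius S" "w \<ge> 0" by auto
      then show ?thesis unfolding 1 even_mem_duplication[OF \<open>odd d\<close>]
        using gap_le_frobenius by fastforce
    next
      case (2 w)
      with that have "w > frobenius S" by auto
      then show ?thesis unfolding 2 odd_mem_duplication[OF \<open>odd d\<close>]
        using gap_le_frobenius by fastforce
    qed
    then show ?thesis by auto
  qed
  then have "UNIV - ?D \<subseteq> {..nat (2 * frobenius S + int d)}"
    by (force simp: not_less[symmetric])
  then show "finite (UNIV - ?D)" by (rule finite_subset) simp
qed

lemma frobenius_duplication:
  assumes "odd d"
  shows "frobenius (numerical_duplication S S d) = 2 * frobenius S + int d"
proof (rule frobenius_eqI)
  show "2 * frobenius S + int d \<notin> int ` numerical_duplication S S d"
    using frobenius_gap by (simp add: odd_mem_duplication[OF assms])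
next
  fix z assume z: "z > 2 * frobenius S + int d"
  show "z \<in> int ` numerical_duplication S S d"
  proof (cases z rule: parity_cases[OF \<open>odd d\<close>])
    case (1 w)
    with z have "w > frobenius S" by auto
    then show ?thesis unfolding 1 even_mem_duplication[OF \<open>odd d\<close>]
      using gap_le_frobenius by fastforce
  next
    case (2 w)
    with z have "w > frobenius S" by auto
    then show ?thesis unfolding 2 odd_mem_duplication[OF \<open>odd d\<close>]
      using gap_le_frobenius by fastforce
  qed
qed

lemma multiplicity_duplication:
  assumes "d \<in> S" and "odd d"
  shows "sg_multiplicity (numerical_duplication S S d) = min (2 * sg_multiplicity S) d"
  unfolding sg_multiplicity_def[of "numerical_duplication S S d"]
proof (rule Least_equality)
  have "d \<noteq> 0" using assms by (metis even_zero)
  moreover have "2 * sg_multiplicity S \<in> numerical_duplication S S d"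
    using multiplicity_mem by (auto simp: numerical_duplication_def)
  moreover have "2 * 0 + d \<in> numerical_duplication S S d"
    using zero_mem unfolding numerical_duplication_def by blast
  ultimately show "min (2 * sg_multiplicity S) d \<in> numerical_duplication S S d \<and>
      min (2 * sg_multiplicity S) d \<noteq> 0"
    using multiplicity_pos by (auto simp: min_def)
next
  fix n assume "n \<in> numerical_duplication S S d \<and> n \<noteq> 0"
  then show "min (2 * sg_multiplicity S) d \<le> n"
    using multiplicity_le by (fastforce simp: numerical_duplication_def)
qed

text \<open>An odd number \<open>2 f + d\<close> is moved to \<open>2 (f + s) + d\<close> and to \<open>2 (f + s + d)\<close> by the two kinds of
  elements, and \<open>s + d\<close> is again a nonzero element of \<open>S\<close>; so it is pseudo-Frobenius exactly if \<open>f\<close> is.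
  An even number \<open>2 f\<close> fails already for the element \<open>d\<close>.\<close>
lemma pseudo_frobenius_duplication:
  assumes "d \<in> S" and "odd d"
  shows "pseudo_frobenius (numerical_duplication S S d) =
    (\<lambda>f. 2 * f + int d) ` pseudo_frobenius S" (is "pseudo_frobenius ?D = _")
proof -
  have d0: "d \<noteq> 0" using assms by (metis even_zero)
  have split: "z \<in> pseudo_frobenius ?D \<longleftrightarrow> z \<notin> int ` ?D
      \<and> (\<forall>s\<in>S - {0}. z + 2 * int s \<in> int ` ?D) \<and> (\<forall>s\<in>S. z + (2 * int s + int d) \<in> int ` ?D)" for z
  proof -
    have "?D - {0} = (\<lambda>s. 2 * s) ` (S - {0}) \<union> (\<lambda>s. 2 * s + d) ` S"
      using d0 by (auto simp: numerical_duplication_def)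
    then show ?thesis by (simp add: pseudo_frobenius_def ball_Un)
  qed
  have odd: "2 * f + int d \<in> pseudo_frobenius ?D \<longleftrightarrow> f \<in> pseudo_frobenius S" for f
  proof -
    have 1: "2 * f + int d + 2 * int s = 2 * (f + int s) + int d"
      "2 * f + int d + (2 * int s + int d) = 2 * (f + int (s + d))" for s by auto
    have "s + d \<in> S - {0}" if "s \<in> S" for s using that assms d0 add_mem by auto
    then show ?thesis
      unfolding split 1 odd_mem_duplication[OF \<open>odd d\<close>] even_mem_duplication[OF \<open>odd d\<close>]
      unfolding pseudo_frobenius_def by blast
  qed
  have even: "2 * f \<notin> pseudo_frobenius ?D" for f
  proof
    assume "2 * f \<in> pseudo_frobenius ?D"
    then have "2 * f \<notin> int ` ?D" "2 * f + int d \<in> int ` ?D"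
      using zero_mem unfolding split by force+
    then show False
      unfolding odd_mem_duplication[OF \<open>odd d\<close>] even_mem_duplication[OF \<open>odd d\<close>] by blast
  qed
  show ?thesis
  proof (rule Set.set_eqI)
    fix z show "z \<in> pseudo_frobenius ?D \<longleftrightarrow> z \<in> (\<lambda>f. 2 * f + int d) ` pseudo_frobenius S"
    proof (cases z rule: parity_cases[OF \<open>odd d\<close>])
      case (1 w)
      then have "z \<noteq> 2 * f + int d" for f using \<open>odd d\<close> by presburger
      with 1 even show ?thesis by auto
    next
      case (2 w)
      then show ?thesis unfolding 2 odd by (simp add: inj_image_mem_iff[of "\<lambda>f. 2 * f + int d"] inj_on_def)
    qed
  qed
qed

end

section \<open>Laurent series with prescribed support\<close>

definition fls_on :: "nat set \<Rightarrow> 'k::field fls set" where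
  "fls_on T = {f. \<forall>n. f $$ n \<noteq> 0 \<longrightarrow> n \<in> int ` T}"

lemma fls_onD: "f \<in> fls_on T \<Longrightarrow> f $$ n \<noteq> 0 \<Longrightarrow> n \<in> int ` T"
  by (simp add: fls_on_def)

lemma fls_onI: "(\<And>n. f $$ n \<noteq> 0 \<Longrightarrow> n \<in> int ` T) \<Longrightarrow> f \<in> fls_on T"
  by (simp add: fls_on_def)

lemma fls_on_mono: "T \<subseteq> T' \<Longrightarrow> fls_on T \<subseteq> fls_on T'"
  unfolding fls_on_def by blast

lemma fls_on_zero: "0 \<in> fls_on T"
  by (simp add: fls_on_def)

lemma fls_on_add: "f \<in> fls_on T \<Longrightarrow> g \<in> fls_on T \<Longrightarrow> f + g \<in> fls_on T"
  unfolding fls_on_def by (auto, metis add_0)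

lemma fls_on_uminus: "f \<in> fls_on T \<Longrightarrow> - f \<in> fls_on T"
  by (simp add: fls_on_def)

lemma fls_on_diff: "f \<in> fls_on T \<Longrightarrow> g \<in> fls_on T \<Longrightarrow> f - g \<in> fls_on T"
  using fls_on_add[of f T "- g"] fls_on_uminus[of g T] by simp

lemma fls_X_power_mem_fls_on_iff [simp]: "(fls_X ^ n :: 'k::field fls) \<in> fls_on T \<longleftrightarrow> n \<in> T"
  by (auto simp: fls_on_def)

lemma fls_const_mem_fls_on: "0 \<in> T \<Longrightarrow> fls_const c \<in> fls_on T"
  by (auto simp: fls_on_def)

lemma fls_const_mult_mem_fls_on: "f \<in> fls_on T \<Longrightarrow> fls_const c * f \<in> fls_on T"
  by (auto simp: fls_on_def)

lemma fls_X_power_times_nth: "(fls_X ^ m * f :: 'k::field fls) $$ n = f $$ (n - int m)"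
  by (simp add: fls_X_power_times_conv_shift)

lemma fls_times_nth_nonzeroE:
  fixes f g :: "'k::field fls"
  assumes "(f * g) $$ n \<noteq> 0"
  obtains i where "f $$ i \<noteq> 0" "g $$ (n - i) \<noteq> 0"
proof -
  have "\<exists>i. f $$ i * g $$ (n - i) \<noteq> 0"
    using assms unfolding fls_times_nth(2) by (meson sum.neutral)
  then show ?thesis using that by auto
qed

lemma fls_on_mult:
  assumes "f \<in> fls_on T" "g \<in> fls_on T'" and "\<And>a b. a \<in> T \<Longrightarrow> b \<in> T' \<Longrightarrow> a + b \<in> U"
  shows "f * g \<in> fls_on U"
proof (rule fls_onI)
  fix n assume "(f * g) $$ n \<noteq> 0"
  then obtain i where i: "f $$ i \<noteq> 0" "g $$ (n - i) \<noteq> 0" by (rule fls_times_nth_nonzeroE)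
  obtain a b where "a \<in> T" "i = int a" "b \<in> T'" "n - i = int b"
    using fls_onD[OF assms(1) i(1)] fls_onD[OF assms(2) i(2)] by auto
  then have "n = int (a + b)" "a + b \<in> U" using assms(3) by auto
  then show "n \<in> int ` U" by blast
qed

lemma fls_X_power_times_mem_fls_on_iff:
  "fls_X ^ m * f \<in> fls_on ((+) m ` T) \<longleftrightarrow> f \<in> fls_on T"
proof -
  have "n - int m \<in> int ` T \<longleftrightarrow> n \<in> int ` (+) m ` T" for n
  proof
    assume "n - int m \<in> int ` T"
    then obtain t where "t \<in> T" "n = int (m + t)" by auto
    then show "n \<in> int ` (+) m ` T" by blast
  qed auto
  moreover have "(\<forall>n. f $$ n \<noteq> 0 \<longrightarrow> n \<in> int ` T)
      \<longleftrightarrow> (\<forall>n. f $$ (n - int m) \<noteq> 0 \<longrightarrow> n - int m \<in> int ` T)"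
    by (metis add_diff_cancel_right')
  ultimately show ?thesis
    by (simp add: fls_on_def fls_X_power_times_nth)
qed

lemma fls_X_power_times_fls_on: "(\<lambda>f. fls_X ^ m * f) ` fls_on T = fls_on ((+) m ` T)"
proof (intro equalityI subsetI)
  fix g :: "'a fls" assume g: "g \<in> fls_on ((+) m ` T)"
  have "fls_X ^ m * fls_shift (int m) g = g"
    by (intro fls_eqI) (simp add: fls_X_power_times_nth)
  then show "g \<in> (\<lambda>f. fls_X ^ m * f) ` fls_on T"
    using g fls_X_power_times_mem_fls_on_iff by (metis image_eqI)
qed (auto simp: fls_X_power_times_mem_fls_on_iff)

section \<open>The semigroup ring and its conductor\<close>

lemma cring_ring_on:
  fixes A :: "'a::field set"
  assumes "0 \<in> A" "1 \<in> A" and "\<And>a b. a \<in> A \<Longrightarrow> b \<in> A \<Longrightarrow> a + b \<in> A"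
    and "\<And>a b. a \<in> A \<Longrightarrow> b \<in> A \<Longrightarrow> a * b \<in> A" and "\<And>a. a \<in> A \<Longrightarrow> - a \<in> A"
  shows "cring (ring_on A)"
proof (rule cringI)
  show "abelian_group (ring_on A)"
  proof (rule abelian_groupI)
    fix a assume "a \<in> carrier (ring_on A)"
    then show "\<exists>b\<in>carrier (ring_on A). b \<oplus>\<^bsub>ring_on A\<^esub> a = \<zero>\<^bsub>ring_on A\<^esub>"
      using assms(5) by (intro bexI[of _ "- a"]) (auto simp: ring_on_def)
  qed (use assms in \<open>auto simp: ring_on_def\<close>)
  show "Group.comm_monoid (ring_on A)"
    by (rule comm_monoidI) (use assms in \<open>auto simp: ring_on_def\<close>)
qed (auto simp: ring_on_def algebra_simps)

context numsemi
begin

lemma cring_fls_on: "cring (ring_on (fls_on S :: 'k::field fls set))"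
  using fls_const_mem_fls_on[OF zero_mem, of "1 :: 'k"]
  by (intro cring_ring_on fls_on_zero fls_on_add fls_on_uminus fls_on_mult[of _ S _ S])
    (auto intro: add_mem)

lemma finite_minimal_generators: "finite (minimal_generators S)"
proof (rule finite_subset)
  let ?m = "sg_multiplicity S"
  show "minimal_generators S \<subseteq> {..nat (frobenius S) + ?m}"
  proof
    fix n assume n: "n \<in> minimal_generators S"
    show "n \<in> {..nat (frobenius S) + ?m}"
    proof (rule ccontr)
      assume "n \<notin> {..nat (frobenius S) + ?m}"
      then have big: "int (n - ?m) > frobenius S" "n - ?m \<noteq> 0" "n = ?m + (n - ?m)" by auto
      then have "?m \<in> S - {0}" "n - ?m \<in> S - {0}"
        using above_frobenius multiplicity_mem multiplicity_pos by auto
      with big(3) have "\<exists>a\<in>S - {0}. \<exists>b\<in>S - {0}. n = a + b" by blast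
      with n show False by (auto simp: minimal_generators_def)
    qed
  qed
qed simp

text \<open>Every nonzero element that is not itself a minimal generator splits into two smaller nonzero ones.\<close>
lemma exists_exponents:
  assumes "s \<in> S"
  shows "\<exists>a \<in> minimal_generators S \<rightarrow>\<^sub>E UNIV. (\<Sum>g\<in>minimal_generators S. a g * g) = s"
  using assms
proof (induction s rule: less_induct)
  case (less s)
  let ?G = "minimal_generators S"
  consider "s = 0" | "s \<in> ?G" | t u where "t \<in> S" "u \<in> S" "t \<noteq> 0" "u \<noteq> 0" "s = t + u"
    using less.prems unfolding minimal_generators_def by blast
  then show ?case
  proof cases
    case 1
    then show ?thesis by (intro bexI[of _ "restrict (\<lambda>_. 0) ?G"]) auto
  next
    case 2
    then have "(\<Sum>g\<in>?G. restrict (\<lambda>g. if g = s then 1 else 0) ?G g * g) = s"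
      using finite_minimal_generators by (simp add: if_distrib[of "\<lambda>x. x * _"] cong: if_cong)
    then show ?thesis by (intro bexI[of _ "restrict (\<lambda>g. if g = s then 1 else 0) ?G"]) auto
  next
    case 3
    with less.IH[of t] less.IH[of u] obtain a b where
      "(\<Sum>g\<in>?G. a g * g) = t" "(\<Sum>g\<in>?G. b g * g) = u" by fastforce
    then have "(\<Sum>g\<in>?G. restrict (\<lambda>g. a g + b g) ?G g * g) = s"
      using 3 by (simp add: sum.distrib algebra_simps)
    then show ?thesis by (intro bexI[of _ "restrict (\<lambda>g. a g + b g) ?G"]) auto
  qed
qed

lemma exponents_mem: "(\<Sum>g\<in>minimal_generators S. a g * g) \<in> S"
proof -
  have "(\<Sum>g\<in>G. a g * g) \<in> S" if "G \<subseteq> S" "finite G" for G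
    using that(2,1) by (induction G) (auto simp: zero_mem add_mem mult_mem)
  then show ?thesis
    using finite_minimal_generators by (auto simp: minimal_generators_def)
qed

text \<open>In the definition of \<^const>\<open>semigroup_ring\<close> a sum over an infinite set would silently be zero; minimal
  generators are positive, which bounds each exponent by \<open>n\<close>.\<close>
lemma finite_exponents:
  "finite {a \<in> minimal_generators S \<rightarrow>\<^sub>E UNIV. (\<Sum>g\<in>minimal_generators S. a g * g) = n}"
proof (rule finite_subset)
  let ?G = "minimal_generators S"
  show "{a \<in> ?G \<rightarrow>\<^sub>E UNIV. (\<Sum>g\<in>?G. a g * g) = n} \<subseteq> (?G \<rightarrow>\<^sub>E {..n})"
  proof (intro subsetI PiE_I)
    fix a g assume a: "a \<in> {a \<in> ?G \<rightarrow>\<^sub>E UNIV. (\<Sum>g\<in>?G. a g * g) = n}" and g: "g \<in> ?G"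
    then have "a g * g \<le> n"
      using member_le_sum[of g ?G "\<lambda>g. a g * g"] finite_minimal_generators by auto
    moreover have "1 \<le> g" using g by (auto simp: minimal_generators_def)
    then have "a g \<le> a g * g" by simp
    ultimately show "a g \<in> {..n}" unfolding atMost_iff by (rule order_trans[rotated])
  qed (auto simp: PiE_def extensional_def)
  show "finite (?G \<rightarrow>\<^sub>E {..n})"
    by (intro finite_PiE finite_minimal_generators) auto
qed

text \<open>The substitution is onto the series supported in \<open>S\<close>: choose one exponent vector for each element
  of \<open>S\<close> and put the whole coefficient there.\<close>
lemma semigroup_ring_eq: "semigroup_ring S = (fls_on S :: 'k::field fls set)"
proof (intro equalityI subsetI)
  let ?G = "minimal_generators S"
  let ?E = "\<lambda>n. {a \<in> ?G \<rightarrow>\<^sub>E UNIV. (\<Sum>g\<in>?G. a g * g) = n}"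
  fix f :: "'k fls"
  show "f \<in> fls_on S" if "f \<in> semigroup_ring S"
  proof (rule fls_onI)
    fix n assume n: "f $$ n \<noteq> 0"
    from that obtain c :: "(nat \<Rightarrow> nat) \<Rightarrow> 'k" where f: "f = fps_to_fls (Abs_fps (\<lambda>n. \<Sum>a \<in> ?E n. c a))"
      by (auto simp: semigroup_ring_def Let_def)
    with n have n0: "n \<ge> 0" and "(\<Sum>a \<in> ?E (nat n). c a) \<noteq> 0" by (auto split: if_splits)
    then obtain a where "a \<in> ?E (nat n)" by (meson sum.neutral)
    with exponents_mem[of a] have "nat n \<in> S" by simp
    with n0 show "n \<in> int ` S" by (auto simp: image_iff intro!: bexI[of _ "nat n"])
  qed
  show "f \<in> semigroup_ring S" if f: "f \<in> fls_on S"
  proof -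
    have "\<forall>s\<in>S. \<exists>a. a \<in> ?E s" using exists_exponents by blast
    then obtain e where e: "\<And>s. s \<in> S \<Longrightarrow> e s \<in> ?E s" by (rule bchoice[THEN exE]) blast
    define c :: "(nat \<Rightarrow> nat) \<Rightarrow> 'k" where
      "c a = (let n = \<Sum>g\<in>?G. a g * g in if a = e n then f $$ int n else 0)" for a
    have coeff: "(\<Sum>a \<in> ?E n. c a) = f $$ int n" for n
    proof (cases "n \<in> S")
      case True
      have "(\<Sum>a \<in> ?E n. c a) = (\<Sum>a \<in> ?E n. if a = e n then f $$ int n else 0)"
        by (intro sum.cong) (auto simp: c_def Let_def)
      also have "\<dots> = f $$ int n"
        using finite_exponents e[OF True] by (subst sum.delta) auto
      finally show ?thesis .
    next
      case False
      then have "?E n = {}" using exponents_mem by auto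
      moreover have "f $$ int n = 0" using fls_onD[OF f] False by fastforce
      ultimately show ?thesis by (metis sum.empty)
    qed
    have "f $$ n = 0" if "n < 0" for n using fls_onD[OF f, of n] that by fastforce
    then have "f = fps_to_fls (Abs_fps (\<lambda>n. \<Sum>a \<in> ?E n. c a))"
      unfolding coeff by (intro fls_eqI) auto
    then show ?thesis
      unfolding semigroup_ring_def Let_def by blast
  qed
qed

text \<open>Multiplication by a large power of \<open>t\<close> moves any Laurent series above the Frobenius number.\<close>
lemma quotient_field_fls_on: "quotient_field (fls_on S) = (UNIV :: 'k::field fls set)"
proof (intro equalityI subsetI UNIV_I)
  fix z :: "'k fls"
  define N where "N = nat (frobenius S + 1) + nat (- fls_subdegree z)"
  have "fls_X ^ N * z \<in> fls_on S"
  proof (rule fls_onI)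
    fix n assume "(fls_X ^ N * z) $$ n \<noteq> 0"
    then have "fls_subdegree z \<le> n - int N"
      by (intro fls_subdegree_leI) (simp add: fls_X_power_times_nth)
    moreover have "int N \<ge> frobenius S + 1" "int N \<ge> frobenius S + 1 - fls_subdegree z"
      "int N \<ge> - fls_subdegree z"
      using frobenius_ge by (auto simp: N_def)
    ultimately have "n > frobenius S" "n \<ge> 0" by linarith+
    then have "int (nat n) > frobenius S" "int (nat n) = n" by auto
    then show "n \<in> int ` S" using above_frobenius by (metis image_eqI)
  qed
  moreover have "fls_X ^ N \<in> (fls_on S :: 'k fls set)"
    using above_frobenius by (simp add: N_def)
  moreover have "z = (fls_X ^ N * z) / fls_X ^ N"
    by (subst nonzero_mult_div_cancel_left) simp_all
  moreover have "fls_X ^ N \<noteq> (0 :: 'k fls)" by simp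
  ultimately show "z \<in> quotient_field (fls_on S)"
    unfolding quotient_field_def by blast
qed

text \<open>Power series are integrally closed: a series with a pole of order \<open>e > 0\<close> cannot satisfy a monic
  equation of degree \<open>n\<close>, whose leading term alone has a pole of order \<open>n e\<close>.  Together with the
  integrality of the monomials, this inclusion determines the conductor.\<close>
lemma integral_closure_fls_on:
  assumes z: "z \<in> integral_closure (fls_on S :: 'k::field fls set)"
  shows "z \<in> fls_on UNIV"
proof (cases "fls_subdegree z \<ge> 0")
  case True
  show ?thesis
  proof (rule fls_onI)
    fix n assume "z $$ n \<noteq> 0"
    then have "n \<ge> 0" using True fls_subdegree_leI[of z n] by linarith
    then show "n \<in> range int" by (metis nonneg_int_cases rangeI)
  qed
next
  case False
  then have z0: "z \<noteq> 0" by auto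
  from z obtain p where p: "lead_coeff p = 1" "\<And>i. coeff p i \<in> fls_on S" "poly p z = 0"
    by (auto simp: integral_closure_def)
  let ?n = "degree p" and ?d = "fls_subdegree z"
  \<comment> \<open>The leading term of the integral equation cannot cancel at the exponent \<open>n * d\<close>.\<close>
  have top: "(z ^ ?n) $$ (int ?n * ?d) \<noteq> 0"
    using nth_fls_subdegree_nonzero[of "z ^ ?n"] z0 by (simp add: fls_subdegree_pow)
  have low: "(coeff p i * z ^ i) $$ (int ?n * ?d) = 0" if "i < ?n" for i
  proof (rule ccontr)
    assume "(coeff p i * z ^ i) $$ (int ?n * ?d) \<noteq> 0"
    then obtain j where j: "coeff p i $$ j \<noteq> 0" "(z ^ i) $$ (int ?n * ?d - j) \<noteq> 0"
      by (rule fls_times_nth_nonzeroE)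
    have "j \<ge> 0" using fls_onD[OF p(2) j(1)] by auto
    moreover have "int i * ?d \<le> int ?n * ?d - j"
      using fls_subdegree_leI[OF j(2)] by (simp add: fls_subdegree_pow)
    moreover have "int ?n * ?d < int i * ?d"
      using that False by (intro mult_strict_right_mono_neg) auto
    ultimately show False by linarith
  qed
  have "0 = poly p z $$ (int ?n * ?d)" by (simp add: p)
  also have "\<dots> = (\<Sum>i\<le>?n. (coeff p i * z ^ i) $$ (int ?n * ?d))"
    by (simp add: poly_altdef fls_nth_sum)
  also have "\<dots> = (z ^ ?n) $$ (int ?n * ?d)"
    by (subst sum.remove[of _ ?n]) (use low p(1) in \<open>auto intro!: sum.neutral\<close>)
  finally show ?thesis using top by simp
qed

text \<open>The monomial \<open>t ^ i\<close> is a root of \<open>X ^ m - t ^ (i m)\<close>, where \<open>m\<close> is the multiplicity.\<close>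
lemma fls_X_power_integral: "fls_X ^ i \<in> integral_closure (fls_on S :: 'k::field fls set)"
proof -
  let ?m = "sg_multiplicity S"
  let ?p = "monom 1 ?m - [:fls_X ^ (i * ?m):] :: 'k fls poly"
  have deg: "degree ?p = ?m"
    unfolding diff_conv_add_uminus using multiplicity_pos
    by (subst degree_add_eq_left) (auto simp: degree_monom_eq)
  have "lead_coeff ?p = 1"
    unfolding deg using multiplicity_pos by (simp add: coeff_pCons split: nat.split)
  moreover have "coeff ?p j \<in> fls_on S" for j
    using fls_const_mem_fls_on[OF zero_mem, of "1::'k"] mult_mem[OF multiplicity_mem, of i]
    by (auto simp: coeff_pCons coeff_monom fls_on_zero split: nat.split intro!: fls_on_diff fls_on_uminus)
  moreover have "poly ?p (fls_X ^ i) = 0" by (simp add: poly_monom power_mult)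
  ultimately show ?thesis
    unfolding integral_closure_def quotient_field_fls_on by blast
qed

text \<open>If the support of \<open>z\<close> contained some \<open>n \<le> F\<close>, with \<open>F\<close> the Frobenius number, multiplication by the integral
  element \<open>t ^ (F - n)\<close> would produce a series with \<open>F\<close> in its support.\<close>
lemma conductor_ideal_fls_on:
  "conductor_ideal (fls_on S) = (fls_on {n. int n > frobenius S} :: 'k::field fls set)"
proof (intro equalityI subsetI)
  fix z :: "'k fls"
  show "z \<in> fls_on {n. int n > frobenius S}" if z: "z \<in> conductor_ideal (fls_on S)"
  proof (rule fls_onI)
    fix n assume n: "z $$ n \<noteq> 0"
    have mem: "fls_X ^ i * z \<in> fls_on S" for i
      using z fls_X_power_integral by (auto simp: conductor_ideal_def mult.commute[of _ z])
    have "n \<ge> 0" using fls_onD[OF mem[of 0], of n] n by auto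
    moreover have "n > frobenius S"
    proof (rule ccontr)
      assume "\<not> n > frobenius S"
      then have "(fls_X ^ nat (frobenius S - n) * z) $$ frobenius S \<noteq> 0"
        using n by (simp add: fls_X_power_times_nth)
      then show False using fls_onD[OF mem] frobenius_gap by blast
    qed
    ultimately show "n \<in> int ` {n. int n > frobenius S}"
      by (intro image_eqI[of _ _ "nat n"]) auto
  qed
  show "z \<in> conductor_ideal (fls_on S)" if z: "z \<in> fls_on {n. int n > frobenius S}"
  proof -
    have "z * y \<in> fls_on S" if "y \<in> integral_closure (fls_on S)" for y
      using z integral_closure_fls_on[OF that] by (rule fls_on_mult) (rule above_frobenius, simp)
    then show ?thesis by (simp add: conductor_ideal_def quotient_field_fls_on)
  qed
qed

text \<open>Only the support of the inverse needs an argument.  Its coefficients are given by the recursion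
  that expresses the one at \<open>n\<close> through those at \<open>n - s\<close> with \<open>s \<in> S\<close> nonzero, so by induction they vanish
  off \<open>S\<close>.\<close>
lemma unit_fls_on_iff:
  assumes f: "f \<in> (fls_on S :: 'k::field fls set)"
  shows "f \<in> Units (ring_on (fls_on S)) \<longleftrightarrow> f $$ 0 \<noteq> 0"
proof
  assume "f \<in> Units (ring_on (fls_on S))"
  then obtain g where "g \<in> fls_on S" "f * g = 1"
    by (auto simp: Units_def ring_on_def)
  then have "(f * g) $$ 0 \<noteq> 0" by simp
  then obtain i where i: "f $$ i \<noteq> 0" "g $$ (0 - i) \<noteq> 0" by (rule fls_times_nth_nonzeroE)
  have "i \<ge> 0" "0 - i \<ge> 0" using fls_onD[OF f i(1)] fls_onD[OF \<open>g \<in> fls_on S\<close> i(2)] by auto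
  with i show "f $$ 0 \<noteq> 0" by auto
next
  assume f0: "f $$ 0 \<noteq> 0"
  then have f_nz: "f \<noteq> 0" by auto
  have "f $$ n = 0" if "n < 0" for n using fls_onD[OF f, of n] that by (cases "f $$ n = 0") auto
  then have deg: "fls_subdegree f = 0" using f0 by (intro fls_subdegree_eqI) auto
  let ?g = "inverse f"
  have dg: "fls_subdegree ?g = 0" using deg by simp
  have gneg: "?g $$ n = 0" if "n < 0" for n using that dg by (simp add: fls_eq0_below_subdegree)
  have "?g $$ int n \<noteq> 0 \<longrightarrow> n \<in> S" for n
  proof (induction n rule: less_induct)
    case (less n)
    show ?case
    proof (rule impI, rule ccontr)
      assume gn: "?g $$ int n \<noteq> 0" and nS: "n \<notin> S"
      then have "n \<noteq> 0" using zero_mem by metis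
      \<comment> \<open>Every term of the convolution except \<open>i = 0\<close> vanishes, as \<open>n\<close> is not a sum of elements.\<close>
      have van: "f $$ i * ?g $$ (int n - i) = 0" if i: "i \<in> {0..int n} - {0}" for i
      proof (rule ccontr)
        assume "f $$ i * ?g $$ (int n - i) \<noteq> 0"
        then have fi: "f $$ i \<noteq> 0" and gi: "?g $$ (int n - i) \<noteq> 0" by auto
        from fls_onD[OF f fi] obtain s where s: "s \<in> S" "i = int s" by auto
        with i have "int n - i = int (n - s)" "n - s < n" "n = s + (n - s)" by auto
        with less.IH[of "n - s"] gi s nS add_mem show False by metis
      qed
      have "(f * ?g) $$ int n = (\<Sum>i=0..int n. f $$ i * ?g $$ (int n - i))"
        using fls_times_nth(2)[of f ?g "int n"] deg dg by simp
      also have "\<dots> = f $$ 0 * ?g $$ int n"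
        using sum.remove[of "{0..int n}" 0 "\<lambda>i. f $$ i * ?g $$ (int n - i)"] sum.neutral[of "{0..int n} - {0}", OF ballI, OF van]
        by simp
      finally have "(f * ?g) $$ int n \<noteq> 0" using f0 gn by simp
      moreover have "f * ?g = 1" using f_nz by simp
      ultimately show False using \<open>n \<noteq> 0\<close> by simp
    qed
  qed
  then have "?g \<in> fls_on S"
    using gneg by (intro fls_onI) (metis image_eqI not_less nonneg_int_cases)
  then show "f \<in> Units (ring_on (fls_on S))"
    using f f_nz by (auto simp: Units_def ring_on_def intro!: bexI[of _ "inverse f"])
qed

end

section \<open>The quotient by a monomial parameter\<close>

lemma fls_on_Un_decompose:
  fixes f :: "'k::field fls"
  assumes f: "f \<in> fls_on (T \<union> U)"
  obtains g h where "g \<in> fls_on T" "h \<in> fls_on U" "f = g + h"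
proof
  let ?g = "fps_to_fls (Abs_fps (\<lambda>n. if n \<in> T then f $$ int n else 0))"
  show "?g \<in> fls_on T"
  proof (rule fls_onI)
    fix n assume "?g $$ n \<noteq> 0"
    then have "n \<ge> 0" "nat n \<in> T" by (auto split: if_splits)
    then show "n \<in> int ` T" by (intro image_eqI[of _ _ "nat n"]) auto
  qed
  show "f - ?g \<in> fls_on U"
  proof (rule fls_onI)
    fix n assume n: "(f - ?g) $$ n \<noteq> 0"
    have "n \<in> int ` (T \<union> U)"
    proof (rule ccontr)
      assume notin: "n \<notin> int ` (T \<union> U)"
      then have "f $$ n = 0" using fls_onD[OF f] by blast
      with n have "n \<ge> 0" "nat n \<in> T" by (auto split: if_splits)
      then have "n \<in> int ` T" by (intro image_eqI[of _ _ "nat n"]) auto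
      with notin show False by auto
    qed
    with n show "n \<in> int ` U" by auto
  qed
qed simp

lemma set_add_ring_on: "U <+>\<^bsub>ring_on A\<^esub> V = {u + v | u v. u \<in> U \<and> v \<in> V}"
  by (auto simp: set_add_def' ring_on_def)

locale semigroup_ring_parameter = numsemi +
  fixes m :: nat
  assumes m_mem: "m \<in> S" and m_nonzero: "m \<noteq> 0"
begin

abbreviation R :: "'k::field fls ring" where "R \<equiv> ring_on (fls_on S)"

abbreviation I :: "'k::field fls set" where "I \<equiv> PIdl\<^bsub>R\<^esub> (fls_X ^ m)"

abbreviation cls :: "'k::field fls \<Rightarrow> 'k fls set" where "cls f \<equiv> I +>\<^bsub>R\<^esub> f"

abbreviation K :: "'k::field fls set set" where "K \<equiv> const_classes (fls_on S) (fls_X ^ m)"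

lemma shift_mem_iff: "w \<in> (+) m ` S \<longleftrightarrow> int w - int m \<in> int ` S"
proof
  assume "int w - int m \<in> int ` S"
  then obtain s where "s \<in> S" "w = m + s" by force
  then show "w \<in> (+) m ` S" by blast
qed auto

lemma shift_subset: "(+) m ` S \<subseteq> S"
  using add_mem[OF m_mem] by auto

lemma zero_notin_shift: "0 \<notin> (+) m ` S"
  using m_nonzero by auto

text \<open>This is the Apery set of \<open>S\<close> with respect to \<open>m\<close>; an element \<open>w\<close> of it has \<open>w - m\<close> as a gap.\<close>
lemma finite_apery: "finite (S - (+) m ` S)"
proof (rule finite_subset)
  show "S - (+) m ` S \<subseteq> {..nat (frobenius S + int m)}"
    unfolding subset_iff Diff_iff shift_mem_iff using gap_le_frobenius by fastforce
qed simp

lemma parameter_ideal_eq: "(I :: 'k::field fls set) = fls_on ((+) m ` S)"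
  unfolding fls_X_power_times_fls_on[symmetric]
  by (auto simp: cgenideal_def ring_on_def mult.commute)

lemma ideal_parameter: "ideal I (R :: 'k::field fls ring)"
proof -
  have "fls_X ^ m \<in> carrier (R :: 'k fls ring)" using m_mem by (simp add: ring_on_def)
  then show ?thesis by (rule cring.cgenideal_ideal[OF cring_fls_on])
qed

lemma cls_hom: "ring_hom_ring R (R Quot I) (cls :: 'k::field fls \<Rightarrow> _)"
  by (rule ideal.rcos_ring_hom_ring[OF ideal_parameter])

lemma cls_add: "f \<in> fls_on S \<Longrightarrow> g \<in> fls_on S \<Longrightarrow> cls f \<oplus>\<^bsub>R Quot I\<^esub> cls g = cls (f + g)"
  and cls_mult: "f \<in> fls_on S \<Longrightarrow> g \<in> fls_on S \<Longrightarrow> cls f \<otimes>\<^bsub>R Quot I\<^esub> cls g = cls (f * g)"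
  for f g :: "'k::field fls"
  using ring_hom_add[OF ring_hom_ring.homh[OF cls_hom], of f g]
    ring_hom_mult[OF ring_hom_ring.homh[OF cls_hom], of f g]
  by (simp_all add: ring_on_def)

lemma cls_eq_iff: "cls f = cls g \<longleftrightarrow> f - g \<in> I"
  for f g :: "'k::field fls"
proof -
  have coset: "cls f = {h + f | h. h \<in> fls_on ((+) m ` S)}" for f :: "'k fls"
    unfolding a_r_coset_def' parameter_ideal_eq by (auto simp: ring_on_def)
  show ?thesis
  proof
    assume "cls f = cls g"
    moreover have "0 + f \<in> cls f" unfolding coset using fls_on_zero by blast
    ultimately obtain h where "h \<in> fls_on ((+) m ` S)" "f = h + g" unfolding coset by auto
    then show "f - g \<in> I" by (simp add: parameter_ideal_eq)
  next
    assume "f - g \<in> I"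
    then have d: "f - g \<in> fls_on ((+) m ` S)" by (simp only: parameter_ideal_eq)
    have "h + f = (h + (f - g)) + g" "h + g = (h - (f - g)) + f" for h by auto
    with fls_on_add[OF _ d] fls_on_diff[OF _ d] show "cls f = cls g"
      unfolding coset by blast
  qed
qed

lemma cls_eq_zero_iff: "cls f = \<zero>\<^bsub>R Quot I\<^esub> \<longleftrightarrow> f \<in> I"
  for f :: "'k::field fls"
proof -
  interpret ring_hom_ring R "R Quot I" "cls :: 'k fls \<Rightarrow> _" by (rule cls_hom)
  have "\<zero>\<^bsub>R Quot I\<^esub> = (cls 0 :: 'k fls set)"
    using hom_zero by (simp add: ring_on_def)
  then show ?thesis using cls_eq_iff[of f 0] by simp
qed

lemma carrier_quotient: "carrier (R Quot I) = (cls ` fls_on S :: 'k::field fls set set)"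
proof -
  have "carrier (R :: 'k fls ring) = fls_on S" by (simp add: ring_on_def)
  then show ?thesis by (auto simp: FactRing_def A_RCOSETS_def')
qed

text \<open>Dimensions over the constants are only well defined once these form a subfield of the quotient;
  the quotient map is injective on them because \<open>1\<close> is not a multiple of \<open>t ^ m\<close>.\<close>
lemma subfield_const_classes: "subfield K (R Quot I :: 'k::field fls set ring)"
proof -
  interpret R: cring "R :: 'k fls ring" by (rule cring_fls_on)
  interpret hom: ring_hom_ring R "R Quot I" "cls :: 'k fls \<Rightarrow> _" by (rule cls_hom)
  have minus: "\<ominus>\<^bsub>R\<^esub> fls_const c = fls_const (- c)" for c :: 'k
    using fls_const_mem_fls_on[OF zero_mem]
    by (intro R.minus_equality) (auto simp: ring_on_def fls_plus_const intro: fls_on_uminus)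
  have "subring (range fls_const) (R :: 'k fls ring)"
  proof (rule R.subringI)
    show "range fls_const \<subseteq> carrier (R :: 'k fls ring)"
      using fls_const_mem_fls_on[OF zero_mem] by (auto simp: ring_on_def)
  qed (auto simp: minus, auto simp: ring_on_def fls_const_mult_const fls_plus_const
      simp flip: fls_const_uminus intro: range_eqI[of _ _ 1])
  then have "subcring (range fls_const) (R :: 'k fls ring)" by (rule R.subcringI')
  moreover have "Units (R\<lparr>carrier := range fls_const\<rparr>) = range fls_const - {\<zero>\<^bsub>R :: 'k fls ring\<^esub>}"
    (is "?U = ?N")
  proof (intro equalityI subsetI)
    fix f :: "'k fls" assume "f \<in> ?N"
    then obtain c where "f = fls_const c" "c \<noteq> 0" by (auto simp: ring_on_def)
    then show "f \<in> ?U"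
      by (auto simp: Units_def ring_on_def fls_const_mult_const intro!: exI[of _ "inverse c"])
  qed (auto simp: Units_def ring_on_def)
  ultimately have "subfield (range fls_const) (R :: 'k fls ring)" by (rule R.subfieldI)
  moreover have "\<one>\<^bsub>R Quot I\<^esub> \<noteq> (\<zero>\<^bsub>R Quot I\<^esub> :: 'k fls set)"
  proof -
    have "\<one>\<^bsub>R Quot I\<^esub> = (cls 1 :: 'k fls set)"
      using hom.hom_one by (simp add: ring_on_def)
    moreover have "(1 :: 'k fls) \<notin> I"
      using fls_X_power_mem_fls_on_iff[of 0 "(+) m ` S", where 'k = 'k] zero_notin_shift
      by (simp add: parameter_ideal_eq)
    ultimately show ?thesis using cls_eq_zero_iff by metis
  qed
  ultimately have "subfield (cls ` range fls_const) (R Quot I :: 'k fls set ring)"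
    by (rule ring_hom_ring.img_is_subfield(2)[OF cls_hom])
  then show ?thesis by (simp add: const_classes_def image_image)
qed

lemma line_extension_cls:
  fixes T
  assumes "w \<in> S" "T \<subseteq> S"
  shows "ring.line_extension (R Quot I) K (cls (fls_X ^ w)) (cls ` fls_on T)
    = (cls ` fls_on (insert w T) :: 'k::field fls set set)"
proof -
  interpret Q: ring "R Quot I :: 'k fls set ring"
    by (rule ideal.quotient_is_ring[OF ideal_parameter])
  have comb: "cls (fls_const c) \<otimes>\<^bsub>R Quot I\<^esub> cls (fls_X ^ w) \<oplus>\<^bsub>R Quot I\<^esub> cls g
      = cls (fls_const c * fls_X ^ w + g)" if "g \<in> fls_on T" for c :: 'k and g
    using that assms fls_on_mono[OF \<open>T \<subseteq> S\<close>] fls_const_mem_fls_on[OF zero_mem]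
    by (subst cls_mult) (auto intro!: cls_add fls_const_mult_mem_fls_on)
  have "Q.line_extension K (cls (fls_X ^ w)) (cls ` fls_on T)
      = {cls (fls_const c) \<otimes>\<^bsub>R Quot I\<^esub> cls (fls_X ^ w) \<oplus>\<^bsub>R Quot I\<^esub> cls g | c g. g \<in> fls_on T}"
    unfolding Q.line_extension_def set_add_def' r_coset_def const_classes_def by auto
  also have "\<dots> = {cls (fls_const c * fls_X ^ w + g) | c g. g \<in> fls_on T}"
    by (rule Collect_cong) (use comb in \<open>fastforce\<close>)
  also have "\<dots> = cls ` {fls_const c * fls_X ^ w + g | c g. g \<in> fls_on T}"
    by blast
  also have "{fls_const c * fls_X ^ w + g | c g. g \<in> fls_on T} = (fls_on (insert w T) :: 'k fls set)"
  proof (intro equalityI subsetI)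
    fix f :: "'k fls" assume "f \<in> {fls_const c * fls_X ^ w + g | c g. g \<in> fls_on T}"
    then show "f \<in> fls_on (insert w T)"
      using fls_on_mono[of T "insert w T"] by (auto intro!: fls_on_add fls_const_mult_mem_fls_on)
  next
    fix f :: "'k fls" assume "f \<in> fls_on (insert w T)"
    then have "f \<in> fls_on ({w} \<union> T)" by simp
    then obtain h g where hg: "h \<in> fls_on {w}" "g \<in> fls_on T" "f = h + g"
      by (rule fls_on_Un_decompose)
    have "h = fls_const (h $$ int w) * fls_X ^ w"
      using fls_onD[OF hg(1)] by (intro fls_eqI) auto
    with hg(2,3) show "f \<in> {fls_const c * fls_X ^ w + g | c g. g \<in> fls_on T}" by force
  qed
  finally show ?thesis .
qed

text \<open>The line added for \<open>w \<notin> m + S\<close> is new, since a difference of \<open>t ^ w\<close> and a series without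
  exponent \<open>w\<close> is not a multiple of \<open>t ^ m\<close>.\<close>
lemma dimension_cls_fls_on:
  assumes "finite B" "B \<subseteq> S - (+) m ` S"
  shows "ring.dimension (R Quot I) (card B) K (cls ` fls_on (B \<union> (+) m ` S) :: 'k::field fls set set)"
  using assms
proof (induction B)
  interpret Q: ring "R Quot I :: 'k fls set ring"
    by (rule ideal.quotient_is_ring[OF ideal_parameter])
  case empty
  have "cls ` fls_on ((+) m ` S) = {\<zero>\<^bsub>R Quot I\<^esub> :: 'k fls set}"
  proof -
    have "cls g = \<zero>\<^bsub>R Quot I\<^esub>" if "g \<in> fls_on ((+) m ` S)" for g :: "'k fls"
      using that by (simp only: cls_eq_zero_iff) (simp only: parameter_ideal_eq)
    moreover have "(0 :: 'k fls) \<in> fls_on ((+) m ` S)" by (rule fls_on_zero)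
    ultimately show ?thesis by (intro equalityI subsetI) (blast, force)
  qed
  then show ?case by simp
next
  interpret Q: ring "R Quot I :: 'k fls set ring"
    by (rule ideal.quotient_is_ring[OF ideal_parameter])
  case (insert w B)
  let ?T = "B \<union> (+) m ` S"
  have w: "w \<in> S" "w \<notin> ?T" using insert.prems insert.hyps by auto
  have T: "?T \<subseteq> S" using insert.prems shift_subset by auto
  have "(cls (fls_X ^ w) :: 'k fls set) \<notin> cls ` fls_on ?T"
  proof
    assume "(cls (fls_X ^ w) :: 'k fls set) \<in> cls ` fls_on ?T"
    then obtain g :: "'k fls" where g: "g \<in> fls_on ?T" "cls (fls_X ^ w) = cls g" by blast
    from g(2) have "fls_X ^ w - g \<in> I" by (simp only: cls_eq_iff)
    then have "fls_X ^ w - g \<in> fls_on ?T"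
      using fls_on_mono[of "(+) m ` S" ?T] by (auto simp: parameter_ideal_eq)
    from fls_on_add[OF this g(1)] w show False by simp
  qed
  moreover have "(cls (fls_X ^ w) :: 'k fls set) \<in> carrier (R Quot I)"
    using w by (simp add: carrier_quotient)
  moreover have "Q.dimension (card B) K (cls ` fls_on ?T)"
    using insert by auto
  ultimately have "Q.dimension (Suc (card B)) K (Q.line_extension K (cls (fls_X ^ w)) (cls ` fls_on ?T))"
    by (intro Q.Suc_dim)
  then show ?case
    using insert.hyps line_extension_cls[OF w(1) T, where 'k = 'k] by simp
qed

lemma dim_cls_fls_on:
  assumes "B \<subseteq> S - (+) m ` S"
  shows "ring.dim (R Quot I) K (cls ` fls_on (B \<union> (+) m ` S) :: 'k::field fls set set) = card B"
proof -
  interpret Q: ring "R Quot I :: 'k fls set ring"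
    by (rule ideal.quotient_is_ring[OF ideal_parameter])
  have "finite B" using assms finite_apery by (rule finite_subset)
  from dimension_cls_fls_on[OF this assms, where 'k = 'k] show ?thesis
    unfolding Q.dim_def over_def
    using Q.dimension_is_inj[OF subfield_const_classes] by (intro the_equality) blast+
qed

section \<open>Type and reduced type of a semigroup ring\<close>

text \<open>The sum of the conductor and the ideal of \<open>t ^ m\<close> consists of the series supported in the union of
  the supports, and the exponents outside \<open>m + S\<close> are counted.\<close>
lemma reduced_type_eq:
  "reduced_type (semigroup_ring S :: 'k::field fls set) (fls_X ^ m)
    = card {w. int w - int m \<notin> int ` S \<and> int w > frobenius S}" (is "_ = card ?B")
proof -
  have B: "?B \<subseteq> S - (+) m ` S"
    unfolding shift_mem_iff[symmetric] using above_frobenius by auto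
  have "fls_on {n. int n > frobenius S} <+>\<^bsub>R\<^esub> I = (fls_on (?B \<union> (+) m ` S) :: 'k fls set)"
  proof (intro equalityI subsetI)
    fix f :: "'k fls" assume "f \<in> fls_on {n. int n > frobenius S} <+>\<^bsub>R\<^esub> I"
    then obtain g h where gh: "g \<in> fls_on {n. int n > frobenius S}" "h \<in> fls_on ((+) m ` S)" "f = g + h"
      by (auto simp: set_add_ring_on parameter_ideal_eq)
    have "{n. int n > frobenius S} \<subseteq> ?B \<union> (+) m ` S"
      using shift_mem_iff by blast
    with gh show "f \<in> fls_on (?B \<union> (+) m ` S)"
      using fls_on_mono[of _ "?B \<union> (+) m ` S"] by (blast intro: fls_on_add)
  next
    fix f :: "'k fls" assume "f \<in> fls_on (?B \<union> (+) m ` S)"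
    then obtain g h where gh: "g \<in> fls_on ?B" "h \<in> fls_on ((+) m ` S)" "f = g + h"
      by (rule fls_on_Un_decompose)
    moreover have "g \<in> fls_on {n. int n > frobenius S}"
      using gh(1) fls_on_mono[of ?B "{n. int n > frobenius S}"] by blast
    ultimately show "f \<in> fls_on {n. int n > frobenius S} <+>\<^bsub>R\<^esub> I"
      by (auto simp: set_add_ring_on parameter_ideal_eq)
  qed
  with dim_cls_fls_on[OF B, where 'k = 'k] show ?thesis
    by (simp add: reduced_type_def Let_def semigroup_ring_eq conductor_ideal_fls_on)
qed

text \<open>To be killed by the monomials \<open>t ^ s\<close> forces every \<open>w\<close> in the support to satisfy
  \<open>w + s \<in> m + S\<close>, that is, \<open>w - m\<close> to be pseudo-Frobenius or \<open>w\<close> to lie in \<open>m + S\<close>.  Conversely, series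
  with such supports are killed by all nonunits, as those are supported in the nonzero elements.\<close>
lemma cm_type_eq:
  "cm_type (semigroup_ring S :: 'k::field fls set) (fls_X ^ m)
    = card {w. int w - int m \<in> pseudo_frobenius S}" (is "_ = card ?B")
proof -
  have B: "?B \<subseteq> S - (+) m ` S"
    unfolding shift_mem_iff subset_iff Diff_iff using m_mem m_nonzero by (force simp: pseudo_frobenius_def)
  let ?T = "?B \<union> (+) m ` S"
  have annihilated: "(\<forall>a \<in> fls_on S. a $$ 0 = 0 \<longrightarrow> a * f \<in> I) \<longleftrightarrow> f \<in> fls_on ?T"
    if f: "f \<in> fls_on S" for f :: "'k fls"
  proof
    assume ann: "\<forall>a \<in> fls_on S. a $$ 0 = 0 \<longrightarrow> a * f \<in> I"
    show "f \<in> fls_on ?T"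
    proof (rule fls_onI)
      fix n assume n: "f $$ n \<noteq> 0"
      from fls_onD[OF f n] obtain w where w: "n = int w" "w \<in> S" by auto
      have "(int w - int m) + int s \<in> int ` S" if "s \<in> S - {0}" for s
      proof -
        have "fls_X ^ s * f \<in> fls_on ((+) m ` S)"
          using ann that unfolding parameter_ideal_eq by simp
        moreover have "(fls_X ^ s * f) $$ int (w + s) \<noteq> 0"
          using n w by (simp add: fls_X_power_times_nth)
        ultimately have "int (w + s) \<in> int ` (+) m ` S" by (rule fls_onD)
        then have "w + s \<in> (+) m ` S" by (metis image_iff of_nat_eq_iff)
        then show ?thesis unfolding shift_mem_iff by (simp add: algebra_simps)
      qed
      then show "n \<in> int ` ?T"
        using w by (auto simp: pseudo_frobenius_def shift_mem_iff)
    qed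
  next
    assume fT: "f \<in> fls_on ?T"
    show "\<forall>a \<in> fls_on S. a $$ 0 = 0 \<longrightarrow> a * f \<in> I"
    proof (intro ballI impI)
      fix a :: "'k fls" assume a: "a \<in> fls_on S" "a $$ 0 = 0"
      have "a \<in> fls_on (S - {0})"
      proof (rule fls_onI)
        fix n assume n: "a $$ n \<noteq> 0"
        with a(2) have "n \<noteq> 0" by metis
        with fls_onD[OF a(1) n] show "n \<in> int ` (S - {0})" by auto
      qed
      then show "a * f \<in> I"
        unfolding parameter_ideal_eq using fT
      proof (rule fls_on_mult)
        fix s w assume s: "s \<in> S - {0}" and w: "w \<in> ?T"
        have "(int w - int m) + int s \<in> int ` S"
        proof (cases "w \<in> ?B")
          case True
          with s show ?thesis by (auto simp: pseudo_frobenius_def)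
        next
          case False
          with w obtain t where "t \<in> S" "w = m + t" by auto
          with s add_mem have "(int w - int m) + int s = int (t + s)" "t + s \<in> S" by auto
          then show ?thesis by blast
        qed
        then show "s + w \<in> (+) m ` S" unfolding shift_mem_iff by (simp add: algebra_simps)
      qed
    qed
  qed
  have nonunit: "a \<in> carrier R - Units R \<longleftrightarrow> a \<in> fls_on S \<and> a $$ 0 = 0" for a :: "'k fls"
    using unit_fls_on_iff[of a] by (auto simp: ring_on_def)
  have "quot_socle (fls_on S) (fls_X ^ m)
      = {q \<in> carrier (R Quot I). \<forall>a \<in> carrier R - Units R. cls a \<otimes>\<^bsub>R Quot I\<^esub> q = (\<zero>\<^bsub>R Quot I\<^esub> :: 'k fls set)}"
    by (simp add: quot_socle_def Let_def)
  also have "\<dots> = cls ` {f \<in> fls_on S. \<forall>a \<in> fls_on S. a $$ 0 = 0 \<longrightarrow> a * f \<in> I}"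
  proof -
    have "(\<forall>a \<in> carrier R - Units R. cls a \<otimes>\<^bsub>R Quot I\<^esub> cls f = (\<zero>\<^bsub>R Quot I\<^esub> :: 'k fls set))
        \<longleftrightarrow> (\<forall>a \<in> fls_on S. a $$ 0 = 0 \<longrightarrow> a * f \<in> I)" if "f \<in> fls_on S" for f :: "'k fls"
      unfolding Ball_def nonunit using that by (auto simp: cls_mult cls_eq_zero_iff)
    then show ?thesis unfolding carrier_quotient by blast
  qed
  also have "{f \<in> fls_on S. \<forall>a \<in> fls_on S. a $$ 0 = 0 \<longrightarrow> a * f \<in> I} = (fls_on ?T :: 'k fls set)"
    using annihilated fls_on_mono[of ?T S] B shift_subset by blast
  finally have "quot_socle (fls_on S) (fls_X ^ m) = (cls ` fls_on ?T :: 'k fls set set)" .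
  with dim_cls_fls_on[OF B, where 'k = 'k] show ?thesis
    by (simp add: cm_type_def semigroup_ring_eq)
qed

end

context numsemi
begin

text \<open>A gap \<open>f\<close> above \<open>F - m\<close> is pseudo-Frobenius because \<open>f + s > F\<close> for every nonzero \<open>s\<close>, the
  multiplicity \<open>m\<close> being the least such.  So one of the two counted sets contains the other, and
  their cardinalities agree only if they coincide.\<close>
lemma maximal_reduced_type_iff:
  "maximal_reduced_type TYPE('k::field) S
    \<longleftrightarrow> (\<forall>f\<in>pseudo_frobenius S. frobenius S - f < int (sg_multiplicity S))"
proof -
  let ?m = "sg_multiplicity S"
  interpret semigroup_ring_parameter S ?m
    using multiplicity_mem multiplicity_pos by unfold_locales auto
  let ?C = "{w. int w - int ?m \<notin> int ` S \<and> int w > frobenius S}"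
  let ?P = "{w. int w - int ?m \<in> pseudo_frobenius S}"
  have "?C \<subseteq> ?P"
  proof
    fix w assume w: "w \<in> ?C"
    have "int w - int ?m + int s \<in> int ` S" if "s \<in> S - {0}" for s
    proof -
      have "int w - int ?m + int s > frobenius S" using w that multiplicity_le[of s] by auto
      then show ?thesis using gap_le_frobenius by force
    qed
    with w show "w \<in> ?P" by (simp add: pseudo_frobenius_def)
  qed
  moreover have "finite ?P"
  proof (rule finite_subset)
    show "?P \<subseteq> {..nat (frobenius S + int ?m)}"
      using gap_le_frobenius by (force simp: pseudo_frobenius_def)
  qed simp
  ultimately have "card ?C = card ?P \<longleftrightarrow> ?P \<subseteq> ?C"
    using card_subset_eq[of ?P ?C] by fastforce
  also have "\<dots> \<longleftrightarrow> (\<forall>f\<in>pseudo_frobenius S. frobenius S - f < int ?m)"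
  proof
    assume P: "?P \<subseteq> ?C"
    show "\<forall>f\<in>pseudo_frobenius S. frobenius S - f < int ?m"
    proof
      fix f assume f: "f \<in> pseudo_frobenius S"
      with multiplicity_mem multiplicity_pos obtain w where "f + int ?m = int w"
        by (force simp: pseudo_frobenius_def)
      then have w: "f = int w - int ?m" by simp
      with f P have "w \<in> ?C" by blast
      with w show "frobenius S - f < int ?m" by simp
    qed
  next
    assume "\<forall>f\<in>pseudo_frobenius S. frobenius S - f < int ?m"
    then show "?P \<subseteq> ?C" by (fastforce simp: pseudo_frobenius_def)
  qed
  finally show ?thesis
    by (simp add: maximal_reduced_type_def Let_def reduced_type_eq cm_type_eq)
qed

end

theorem proposition5p9:
  fixes S :: "nat set" and d :: nat
  assumes "numerical_semigroup S" and "d \<in> S" and "odd d"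
  shows "(d > 2 * sg_multiplicity S \<longrightarrow>
            (maximal_reduced_type TYPE('k::{alg_closed_field, field_char_0}) S \<longleftrightarrow>
             maximal_reduced_type TYPE('k) (numerical_duplication S S d)))
       \<and> (d < 2 * sg_multiplicity S \<longrightarrow>
            (maximal_reduced_type TYPE('k) (numerical_duplication S S d) \<longleftrightarrow>
             (real d - 1) / 2 \<ge> real_of_int (frobenius S - Min (pseudo_frobenius S))))"
proof -
  interpret S: numsemi S using assms(1) by unfold_locales
  interpret D: numsemi "numerical_duplication S S d"
    using S.numerical_semigroup_duplication[OF assms(2,3)] by unfold_locales
  let ?m = "sg_multiplicity S"
  have dup: "maximal_reduced_type TYPE('k) (numerical_duplication S S d) \<longleftrightarrow>
      (\<forall>f\<in>pseudo_frobenius S. 2 * (frobenius S - f) < int (min (2 * ?m) d))"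
    unfolding D.maximal_reduced_type_iff S.pseudo_frobenius_duplication[OF assms(2,3)]
      S.frobenius_duplication[OF assms(3)] S.multiplicity_duplication[OF assms(2,3)]
    by (simp add: algebra_simps)
  have "(\<forall>f\<in>pseudo_frobenius S. 2 * (frobenius S - f) < int d)
      \<longleftrightarrow> 2 * (frobenius S - Min (pseudo_frobenius S)) < int d"
  proof
    have "Min (pseudo_frobenius S) \<in> pseudo_frobenius S"
      using S.finite_pseudo_frobenius S.frobenius_pseudo_frobenius by (intro Min_in) auto
    then show "2 * (frobenius S - Min (pseudo_frobenius S)) < int d"
      if "\<forall>f\<in>pseudo_frobenius S. 2 * (frobenius S - f) < int d" using that by blast
    show "\<forall>f\<in>pseudo_frobenius S. 2 * (frobenius S - f) < int d"
      if "2 * (frobenius S - Min (pseudo_frobenius S)) < int d"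
      using that Min_le[OF S.finite_pseudo_frobenius] by fastforce
  qed
  also have "\<dots> \<longleftrightarrow> 2 * (frobenius S - Min (pseudo_frobenius S)) + 1 \<le> int d" by auto
  also have "\<dots> \<longleftrightarrow> real_of_int (2 * (frobenius S - Min (pseudo_frobenius S)) + 1) \<le> real d" by linarith
  also have "\<dots> \<longleftrightarrow> (real d - 1) / 2 \<ge> real_of_int (frobenius S - Min (pseudo_frobenius S))"
    by auto
  finally show ?thesis
    by (auto simp: dup S.maximal_reduced_type_iff[where 'k = 'k] min_def)
qed

end
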